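(* Let $I=\mathbb{N}$ or $I=\{1,\dots,N\}$ for some $N\in\mathbb{N}$, and let $K=(K(n,j))_{n\in I,\,j\in\mathbb{N}}$ be a stochastic matrix, i.e. $K(n,j)\ge 0$ and $\sum_{j\in\mathbb{N}}K(n,j)=1$ for every $n\in I$. Let $u:\mathbb{N}\to\mathbb{R}$ be a bounded quasi-unimodal sequence and define $v=Ku$ by $v_n=\sum_{j\in\mathbb{N}}K(n,j)u_j$ for $n\in I$. If $K$ is $\mathrm{TP}_3$, then $v$ is quasi-unimodal. If in addition $v$ attains its supremum, then $v$ is unimodal. In particular, if $v$ is a finite sequence, then it is unimodal.
   Context: $\mathbb{N}=\{1,2,\dots\}$. A real matrix (finite or infinite) is $\mathrm{TP}_r$ (totally positive of order $r$) if all its minors of orders $1,\dots,r$ are nonnegative (a minor being the determinant of a finite square submatrix whose rows and columns are taken in increasing order). The number of sign changes of a real sequence is the number of indices at which consecutive terms have opposite signs after all zero terms have been removed (it is $0$ for the zero sequence). A real sequence $u$ is quasi-unimodal if for every $\lambda\in\mathbb{R}$ the sequence $u-\lambda=(u_k-\lambda)_k$ has at most two sign changes and, whenever exactly two sign changes occur, the sign pattern is $-,+,-$. A real sequence $u$ is unimodal if there are indices $k^-\le k^+$ with $u_j\le u_{j+1}$ for $j<k^-$, $u_j=u_{j+1}$ for $k^-\le j<k^+$, and $u_j\ge u_{j+1}$ for $j\ge k^+$ (for a finite sequence only over indices where both terms exist). *)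

theory Defs
  imports
    "HOL-Library.Extended_Nat"
    "HOL-Analysis.Elementary_Metric_Spaces"
    "HOL-Analysis.Infinite_Sum"
    "Jordan_Normal_Form.Determinant"
begin

text \<open>
  The positive integers are the set \<open>{1..}\<close> of type \<open>nat set\<close>. A sequence indexed by
  \<open>I \<subseteq> {1..}\<close> is a function on \<open>nat\<close> of which only the values on \<open>I\<close> matter, and likewise for
  matrices. Minors use the determinant of \<open>Jordan_Normal_Form\<close>, whose size is a number and not
  a type.
\<close>

text \<open>
  \<open>I\<close> and \<open>J\<close> are the row and column index sets; \<open>f\<close> and \<open>g\<close> list the selected rows and columns
  in increasing order.
\<close>

definition totally_positive :: "nat \<Rightarrow> nat set \<Rightarrow> nat set \<Rightarrow> (nat \<Rightarrow> nat \<Rightarrow> real) \<Rightarrow> bool" where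
  "totally_positive r I J K \<longleftrightarrow>
     (\<forall>m\<in>{1..r}. \<forall>f g. strict_mono_on {..<m} f \<and> f ` {..<m} \<subseteq> I \<and>
        strict_mono_on {..<m} g \<and> g ` {..<m} \<subseteq> J \<longrightarrow>
        0 \<le> det (mat m m (\<lambda>(a, b). K (f a) (g b))))"

definition stochastic :: "nat set \<Rightarrow> (nat \<Rightarrow> nat \<Rightarrow> real) \<Rightarrow> bool" where
  "stochastic I K \<longleftrightarrow>
     (\<forall>n\<in>I. (\<forall>j\<in>{1..}. 0 \<le> K n j) \<and> ((\<lambda>j. K n j) has_sum 1) {1..})"

text \<open>
  A sign change is recorded at the index \<open>i\<close> of a nonzero term whose successor among the nonzero
  terms, at index \<open>j\<close>, has the opposite sign.
\<close>

definition sign_changes :: "nat set \<Rightarrow> (nat \<Rightarrow> real) \<Rightarrow> nat set" where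
  "sign_changes I u =
     {i\<in>I. \<exists>j\<in>I. i < j \<and> u i * u j < 0 \<and> (\<forall>k\<in>I. i < k \<and> k < j \<longrightarrow> u k = 0)}"

definition num_sign_changes :: "nat set \<Rightarrow> (nat \<Rightarrow> real) \<Rightarrow> enat" where
  "num_sign_changes I u =
     (if finite (sign_changes I u) then enat (card (sign_changes I u)) else \<infinity>)"

text \<open>
  The sign pattern lists the signs of the successive maximal blocks of equal sign, zero terms being
  ignored; \<open>b\<close> maps the index of each nonzero term to the number of its block.
\<close>

definition has_sign_pattern :: "nat set \<Rightarrow> (nat \<Rightarrow> real) \<Rightarrow> real list \<Rightarrow> bool" where
  "has_sign_pattern I u ss \<longleftrightarrow>
     (\<forall>i. Suc i < length ss \<longrightarrow> ss ! i \<noteq> ss ! Suc i) \<and>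
     (\<exists>b :: nat \<Rightarrow> nat. mono_on {k\<in>I. u k \<noteq> 0} b \<and>
        b ` {k\<in>I. u k \<noteq> 0} = {..<length ss} \<and>
        (\<forall>k\<in>I. u k \<noteq> 0 \<longrightarrow> sgn (u k) = ss ! b k))"

definition quasi_unimodal :: "nat set \<Rightarrow> (nat \<Rightarrow> real) \<Rightarrow> bool" where
  "quasi_unimodal I u \<longleftrightarrow>
     (\<forall>l. num_sign_changes I (\<lambda>k. u k - l) \<le> 2 \<and>
          (num_sign_changes I (\<lambda>k. u k - l) = 2 \<longrightarrow>
             has_sign_pattern I (\<lambda>k. u k - l) [-1, 1, -1]))"

definition unimodal :: "nat set \<Rightarrow> (nat \<Rightarrow> real) \<Rightarrow> bool" where
  "unimodal I u \<longleftrightarrow>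
     (\<exists>p\<in>I. \<exists>q\<in>I. p \<le> q \<and>
        (\<forall>j\<in>I. Suc j \<in> I \<longrightarrow>
           (j < p \<longrightarrow> u j \<le> u (Suc j)) \<and>
           (p \<le> j \<and> j < q \<longrightarrow> u j = u (Suc j)) \<and>
           (q \<le> j \<longrightarrow> u j \<ge> u (Suc j))))"

end

theory Submission
  imports Defs
begin

text \<open>
  A sequence is quasi-unimodal iff it is quasiconcave: \<open>min (u i) (u k) \<le> u j\<close> for
  \<open>i < j < k\<close>. If \<open>v = K u\<close> violates this at rows \<open>n1 < n2 < n3\<close>, subtract a level \<open>l\<close> strictly
  between \<open>v n2\<close> and \<open>min (v n1) (v n3)\<close>, and truncate the sums over the columns to a finite set
  on which the signs at the three rows are still \<open>+, -, +\<close>. The set \<open>B\<close> of columns where \<open>u > l\<close>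
  is an interval; let \<open>A\<close> and \<open>C\<close> be the columns before and after it, and let \<open>a, b, c\<close> be the
  sums over \<open>A, B, C\<close> of the columns restricted to the three rows, weighted by \<open>\<bar>u j - l\<bar>\<close>. All
  minors of \<open>[a, b, c]\<close> are nonnegative, and \<open>y = b - a - c\<close> has signs \<open>+, -, +\<close>. Expanding
  \<open>0 \<le> det [a, b, c] = det [a, y, c]\<close> along \<open>y\<close> forces the minors of \<open>[a, c]\<close> to vanish; then
  the minors of \<open>[a, b]\<close> and \<open>[b, c]\<close> force the second entries of \<open>a\<close> and \<open>c\<close> to vanish, so the
  second entry of \<open>y\<close> is nonnegative, a contradiction.
\<close>

section \<open>Quasi-unimodality as quasiconcavity, and unimodality from a maximiser\<close>

definition quasiconcave_seq :: "nat set \<Rightarrow> (nat \<Rightarrow> real) \<Rightarrow> bool" where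
  "quasiconcave_seq I u \<longleftrightarrow> (\<forall>i\<in>I. \<forall>j\<in>I. \<forall>k\<in>I. i < j \<longrightarrow> j < k \<longrightarrow> min (u i) (u k) \<le> u j)"

text \<open>Let \<open>s\<close> be the last index before \<open>j\<close> at which \<open>w\<close>
  has the sign of \<open>w i\<close>, and \<open>t\<close> the first index after \<open>s\<close>
  with the opposite sign; only zeros can lie between them.\<close>

lemma sign_change_between:
  assumes "i \<in> I" "j \<in> I" "i < j" "w i * w j < 0"
  obtains s where "s \<in> sign_changes I w" "i \<le> s" "s < j"
proof -
  define P where "P = {s\<in>I. i \<le> s \<and> s < j \<and> w i * w s > 0}"
  define s where "s = Max P"
  have wi: "w i \<noteq> 0" using assms by auto
  have P: "finite P" "i \<in> P"
    using assms wi by (auto simp: P_def zero_less_mult_iff)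
  then have "s \<in> P" unfolding s_def using Max_in by blast
  then have s: "s \<in> I" "i \<le> s" "s < j" "w i * w s > 0" by (auto simp: P_def)
  define Q where "Q = {t\<in>I. s < t \<and> t \<le> j \<and> w i * w t < 0}"
  define t where "t = Min Q"
  have Q: "finite Q" "j \<in> Q" using assms s by (auto simp: Q_def)
  then have "t \<in> Q" unfolding t_def using Min_in by blast
  then have t: "t \<in> I" "s < t" "t \<le> j" "w i * w t < 0" by (auto simp: Q_def)
  have "w k = 0" if "k \<in> I" "s < k" "k < t" for k
  proof -
    have "k \<notin> P" using that P(1) Max_ge unfolding s_def by fastforce
    moreover have "k \<notin> Q" using that Q(1) Min_le unfolding t_def by fastforce
    ultimately have "w i * w k = 0" using that s t by (auto simp: P_def Q_def)
    with wi show ?thesis by simp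
  qed
  moreover have "w s * w t < 0"
    using s(4) t(4) by (auto simp: zero_less_mult_iff mult_less_0_iff)
  ultimately have "s \<in> sign_changes I w" using s t unfolding sign_changes_def by blast
  with s that show thesis by blast
qed

text \<open>A level separating a dip at \<open>j\<close> from \<open>i\<close> and \<open>k\<close>
  yields one sign change before \<open>j\<close> and one from \<open>j\<close> on, hence exactly
  two. The pattern has a single positive block; \<open>i\<close> and \<open>k\<close> both lie in
  it, so by monotonicity of \<open>b\<close> the index \<open>j\<close> would as well.\<close>

lemma quasi_unimodal_imp_quasiconcave:
  assumes "quasi_unimodal I u"
  shows "quasiconcave_seq I u"
  unfolding quasiconcave_seq_def
proof (intro ballI impI, rule ccontr)
  fix i j k assume I: "i \<in> I" "j \<in> I" "k \<in> I" and ord: "i < j" "j < k"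
  assume "\<not> min (u i) (u k) \<le> u j"
  then obtain l where l: "u j < l" "l < min (u i) (u k)"
    using dense by (metis not_le)
  define w where "w x = u x - l" for x
  have w: "w i > 0" "w j < 0" "w k > 0" using l by (auto simp: w_def)
  obtain s where s: "s \<in> sign_changes I w" "i \<le> s" "s < j"
    using sign_change_between[of i I j w] I ord w by (auto simp: mult_less_0_iff)
  obtain t where t: "t \<in> sign_changes I w" "j \<le> t" "t < k"
    using sign_change_between[of j I k w] I ord w by (auto simp: mult_less_0_iff)
  have num: "num_sign_changes I w \<le> 2"
    and pat: "num_sign_changes I w = 2 \<longrightarrow> has_sign_pattern I w [-1, 1, -1]"
    using assms unfolding quasi_unimodal_def w_def by blast+
  have fin: "finite (sign_changes I w)"
    using num by (auto simp: num_sign_changes_def numeral_eq_enat split: if_splits)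
  have "card {s, t} \<le> card (sign_changes I w)"
    using s t fin by (intro card_mono) auto
  with s t fin have "2 \<le> num_sign_changes I w"
    by (auto simp: num_sign_changes_def numeral_eq_enat)
  with num pat have "has_sign_pattern I w [-1, 1, -1]" by auto
  then obtain b :: "nat \<Rightarrow> nat" where mono: "mono_on {k\<in>I. w k \<noteq> 0} b"
    and im: "b ` {k\<in>I. w k \<noteq> 0} = {..<3}"
    and sg: "\<And>k. k \<in> I \<Longrightarrow> w k \<noteq> 0 \<Longrightarrow> sgn (w k) = [-1, 1, -1] ! b k"
    unfolding has_sign_pattern_def by auto
  have le: "b i \<le> b j" "b j \<le> b k" using mono I w ord by (auto simp: mono_on_def)
  have less: "b x < 3" if "x \<in> I" "w x \<noteq> 0" for x using im that by auto
  have one: "b x = 1 \<longleftrightarrow> w x > 0" if "x \<in> I" "w x \<noteq> 0" for x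
  proof -
    have "b x = 0 \<or> b x = 1 \<or> b x = 2" using less[OF that] by linarith
    then show ?thesis using sg[OF that] by (auto simp: sgn_if split: if_splits)
  qed
  have "b i = 1" "b j \<noteq> 1" "b k = 1" using one I w by auto
  with le show False by simp
qed

text \<open>Quasiconcavity excludes signs +, -, + at increasing indices. This leaves at most one
  change upwards and one downwards, and the upward one comes first.\<close>

lemma quasiconcave_imp_quasi_unimodal:
  assumes "quasiconcave_seq I u"
  shows "quasi_unimodal I u"
  unfolding quasi_unimodal_def
proof
  fix l
  define w where "w x = u x - l" for x
  have no: False
    if "i \<in> I" "j \<in> I" "k \<in> I" "i < j" "j < k" "w i > 0" "w j < 0" "w k > 0" for i j k
    using assms that unfolding quasiconcave_seq_def w_def by (fastforce simp: min_le_iff_disj)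
  define up where "up s t \<longleftrightarrow> s \<in> I \<and> t \<in> I \<and> s < t \<and> w s < 0 \<and> w t > 0 \<and>
    (\<forall>k\<in>I. s < k \<and> k < t \<longrightarrow> w k = 0)" for s t
  define dn where "dn s t \<longleftrightarrow> s \<in> I \<and> t \<in> I \<and> s < t \<and> w s > 0 \<and> w t < 0 \<and>
    (\<forall>k\<in>I. s < k \<and> k < t \<longrightarrow> w k = 0)" for s t
  have up_next: "t \<le> k" if "up s t" "s < k" "k \<in> I" "w k \<noteq> 0" for s t k
    using that unfolding up_def by (meson not_le)
  have dn_next: "t \<le> k" if "dn s t" "s < k" "k \<in> I" "w k \<noteq> 0" for s t k
    using that unfolding dn_def by (meson not_le)
  \<comment> \<open>Two upward changes would give +, -, + at \<open>t < s' < t'\<close>; below, two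
    downward changes give it at \<open>s < t < s'\<close>.\<close>
  have up_less: "\<not> s < s'" if "up s t" "up s' t'" for s t s' t'
  proof
    assume "s < s'"
    then have "t \<le> s'" using up_next[of s t s'] that by (auto simp: up_def)
    moreover have "t \<noteq> s'" using that unfolding up_def by force
    ultimately show False using no[of t s' t'] that unfolding up_def by auto
  qed
  have dn_less: "\<not> s < s'" if "dn s t" "dn s' t'" for s t s' t'
  proof
    assume "s < s'"
    then have "t \<le> s'" using dn_next[of s t s'] that by (auto simp: dn_def)
    moreover have "t \<noteq> s'" using that unfolding dn_def by force
    ultimately show False using no[of s t s'] that unfolding dn_def by auto
  qed
  have sc: "s \<in> sign_changes I w \<longleftrightarrow> (\<exists>t. up s t) \<or> (\<exists>t. dn s t)" for s
    unfolding sign_changes_def up_def dn_def mult_less_0_iff by blast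
  define U where "U = {s. \<exists>t. up s t}"
  define D where "D = {s. \<exists>t. dn s t}"
  have S: "sign_changes I w = U \<union> D" using sc by (auto simp: U_def D_def)
  have "s = s'" if "s \<in> U" "s' \<in> U" for s s'
    using that by (cases s s' rule: linorder_cases) (auto simp: U_def dest: up_less)
  then have Us: "U = {} \<or> (\<exists>s. U = {s})" by (cases "U = {}") fast+
  have "s = s'" if "s \<in> D" "s' \<in> D" for s s'
    using that by (cases s s' rule: linorder_cases) (auto simp: D_def dest: dn_less)
  then have Ds: "D = {} \<or> (\<exists>s. D = {s})" by (cases "D = {}") fast+
  have num: "num_sign_changes I w = enat (card (U \<union> D))"
    using Us Ds S unfolding num_sign_changes_def by auto
  have "card (U \<union> D) \<le> 2" using Us Ds by (auto simp: card_insert_if)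
  moreover have "has_sign_pattern I w [-1, 1, -1]" if two: "card (U \<union> D) = 2"
  proof -
    obtain p q where "U = {p}" "D = {q}"
      using two Us Ds by (auto simp: card_insert_if split: if_splits)
    then obtain p' q' where p: "up p p'" and q: "dn q q'" unfolding U_def D_def by blast
    have ppos: "p \<in> I" "p' \<in> I" "p < p'" "w p < 0" "w p' > 0" using p by (auto simp: up_def)
    have qpos: "q \<in> I" "q' \<in> I" "q < q'" "w q > 0" "w q' < 0" using q by (auto simp: dn_def)
    have "\<not> q < p" using no[of q p p'] ppos qpos by auto
    then have "p < q" using ppos qpos by (metis less_asym linorder_neqE_nat)
    \<comment> \<open>A change is recorded at the last nonzero index of a block, so the first two
      blocks end at \<open>p\<close> and \<open>q\<close> themselves.\<close>
    define b :: "nat \<Rightarrow> nat" where "b k = (if k \<le> p then 0 else if k \<le> q then 1 else 2)" for k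
    have "mono_on {k\<in>I. w k \<noteq> 0} b" using \<open>p < q\<close> by (auto simp: mono_on_def b_def)
    moreover have "b ` {k\<in>I. w k \<noteq> 0} = {..<3}"
    proof
      show "{..<3} \<subseteq> b ` {k\<in>I. w k \<noteq> 0}"
      proof
        fix x :: nat assume "x \<in> {..<3}"
        then consider "x = b p" | "x = b q" | "x = b q'"
          using \<open>p < q\<close> qpos unfolding b_def by force
        then show "x \<in> b ` {k\<in>I. w k \<noteq> 0}" using ppos qpos by cases auto
      qed
    qed (auto simp: b_def)
    moreover have "sgn (w k) = [-1, 1, -1] ! b k" if k: "k \<in> I" "w k \<noteq> 0" for k
    proof -
      \<comment> \<open>In each case a wrong sign at \<open>k\<close> completes +, -, +: with
        \<open>p, p'\<close>, with \<open>p', q\<close>, or with \<open>q, q'\<close>.\<close>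
      consider "k \<le> p" | "p < k" "k \<le> q" | "q < k" by linarith
      then show ?thesis
      proof cases
        case 1
        then have "w k < 0"
          using no[of k p p'] k ppos by (metis le_neq_implies_less less_asym linorder_neqE)
        with 1 show ?thesis by (simp add: b_def)
      next
        case 2
        have "p' \<le> k" using up_next[OF p] 2 k by blast
        then have "w k > 0"
          using no[of p' k q] k ppos qpos 2 by (metis le_neq_implies_less less_asym linorder_neqE)
        with 2 show ?thesis by (simp add: b_def)
      next
        case 3
        have "q' \<le> k" using dn_next[OF q] 3 k by blast
        then have "w k < 0"
          using no[of q q' k] k qpos by (metis le_neq_implies_less less_asym linorder_neqE)
        with 3 \<open>p < q\<close> show ?thesis by (simp add: b_def)
      qed
    qed
    ultimately show ?thesis
      unfolding has_sign_pattern_def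
      by (intro conjI exI[of _ b]) (auto simp: less_Suc_eq)
  qed
  ultimately show "num_sign_changes I (\<lambda>k. u k - l) \<le> 2 \<and> (num_sign_changes I (\<lambda>k. u k - l) = 2 \<longrightarrow>
      has_sign_pattern I (\<lambda>k. u k - l) [-1, 1, -1])"
    using num unfolding w_def[symmetric] by (auto simp: numeral_eq_enat)
qed

text \<open>The maximiser serves as both ends of the plateau. In a quasiconcavity triple with
  \<open>p\<close> as an outer index, the minimum is the value at the other outer index, which gives
  monotonicity on each side.\<close>

lemma quasiconcave_imp_unimodal:
  assumes "quasiconcave_seq I v" "p \<in> I" "\<And>n. n \<in> I \<Longrightarrow> v n \<le> v p"
  shows "unimodal I v"
  unfolding unimodal_def
proof (intro bexI[of _ p] conjI ballI impI)
  fix j assume j: "j \<in> I" "Suc j \<in> I"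
  show "v j \<le> v (Suc j)" if "j < p"
  proof (cases "Suc j = p")
    case False
    then have "min (v j) (v p) \<le> v (Suc j)"
      using assms(1,2) j that unfolding quasiconcave_seq_def by auto
    then show ?thesis using assms(3)[OF j(1)] by simp
  qed (use assms(3) j in auto)
  show "v (Suc j) \<le> v j" if "p \<le> j"
  proof (cases "j = p")
    case False
    then have "min (v p) (v (Suc j)) \<le> v j"
      using assms(1,2) j that unfolding quasiconcave_seq_def by auto
    then show ?thesis using assms(3)[OF j(2)] by simp
  qed (use assms(3) j in auto)
qed (use assms(2) in auto)

section \<open>Minors of orders two and three as polynomials in the entries\<close>

lemma det_mat_2: "det (mat 2 2 f) = f (0,0) * f (1,1) - f (0,1) * f (1,0)"
  for f :: "nat \<times> nat \<Rightarrow> 'a :: comm_ring_1"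
  by (subst laplace_expansion_row[of _ 2 0])
     (auto simp: cofactor_def mat_delete_def numeral_2_eq_2 det_single)

lemma det_mat_3:
  "det (mat 3 3 f) =
     f (0,0) * (f (1,1) * f (2,2) - f (1,2) * f (2,1))
   - f (0,1) * (f (1,0) * f (2,2) - f (1,2) * f (2,0))
   + f (0,2) * (f (1,0) * f (2,1) - f (1,1) * f (2,0))"
  for f :: "nat \<times> nat \<Rightarrow> 'a :: comm_ring_1"
proof -
  have "det (mat 3 3 f) = (\<Sum>j<3. mat 3 3 f $$ (0, j) * cofactor (mat 3 3 f) 0 j)"
    by (rule laplace_expansion_row) auto
  then show ?thesis
    by (simp add: eval_nat_numeral cofactor_def mat_delete_def
        det_mat_2[unfolded eval_nat_numeral, simplified] algebra_simps)
qed

lemma totally_positive_minor_2: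
  assumes "totally_positive r I J K" "2 \<le> r" "{n1, n2} \<subseteq> I" "n1 < n2" "{j1, j2} \<subseteq> J" "j1 < j2"
  shows "0 \<le> K n1 j1 * K n2 j2 - K n1 j2 * K n2 j1"
proof -
  define f where "f a = (if a = (0::nat) then n1 else n2)" for a
  define g where "g a = (if a = (0::nat) then j1 else j2)" for a
  have "strict_mono_on {..<2} f" "strict_mono_on {..<2} g" "f ` {..<2} \<subseteq> I" "g ` {..<2} \<subseteq> J"
    using assms by (auto simp: strict_mono_on_def f_def g_def)
  then have "0 \<le> det (mat 2 2 (\<lambda>(a, b). K (f a) (g b)))"
    using assms(1,2) unfolding totally_positive_def by auto
  then show ?thesis by (simp add: det_mat_2 f_def g_def)
qed

lemma totally_positive_minor_3:
  assumes "totally_positive r I J K" "3 \<le> r" "{n1, n2, n3} \<subseteq> I" "n1 < n2" "n2 < n3"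
    "{j1, j2, j3} \<subseteq> J" "j1 < j2" "j2 < j3"
  shows "0 \<le> K n1 j1 * (K n2 j2 * K n3 j3 - K n2 j3 * K n3 j2)
    - K n1 j2 * (K n2 j1 * K n3 j3 - K n2 j3 * K n3 j1)
    + K n1 j3 * (K n2 j1 * K n3 j2 - K n2 j2 * K n3 j1)"
proof -
  define f where "f a = (if a = (0::nat) then n1 else if a = 1 then n2 else n3)" for a
  define g where "g a = (if a = (0::nat) then j1 else if a = 1 then j2 else j3)" for a
  have "strict_mono_on {..<3} f" "strict_mono_on {..<3} g" "f ` {..<3} \<subseteq> I" "g ` {..<3} \<subseteq> J"
    using assms by (auto simp: strict_mono_on_def f_def g_def)
  then have "0 \<le> det (mat 3 3 (\<lambda>(a, b). K (f a) (g b)))"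
    using assms(1,2) unfolding totally_positive_def by auto
  then show ?thesis by (simp add: det_mat_3 f_def g_def)
qed

section \<open>Aggregation of columns with nonnegative weights\<close>

text \<open>A minor is linear in each column. With \<open>p\<close>, \<open>q\<close>,
  \<open>r\<close> as cofactors, this replaces one column by a weighted sum of columns.\<close>

lemma nonneg_combination:
  fixes p q r :: real
  assumes "\<And>j. j \<in> A \<Longrightarrow> 0 \<le> p * x j + q * y j + r * z j" "\<And>j. j \<in> A \<Longrightarrow> 0 \<le> \<alpha> j"
  shows "0 \<le> p * (\<Sum>j\<in>A. x j * \<alpha> j) + q * (\<Sum>j\<in>A. y j * \<alpha> j) + r * (\<Sum>j\<in>A. z j * \<alpha> j)"
proof -
  have "0 \<le> (\<Sum>j\<in>A. (p * x j + q * y j + r * z j) * \<alpha> j)"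
    using assms by (intro sum_nonneg) auto
  also have "\<dots> = p * (\<Sum>j\<in>A. x j * \<alpha> j) + q * (\<Sum>j\<in>A. y j * \<alpha> j) + r * (\<Sum>j\<in>A. z j * \<alpha> j)"
    by (simp add: sum_distrib_left flip: sum.distrib) (simp add: algebra_simps)
  finally show ?thesis .
qed

lemma aggregated_minor_2:
  fixes x y :: "'a \<Rightarrow> real"
  assumes "\<And>j l. j \<in> A \<Longrightarrow> l \<in> B \<Longrightarrow> 0 \<le> x j * y l - x l * y j"
    and "\<And>j. j \<in> A \<Longrightarrow> 0 \<le> \<alpha> j" "\<And>j. j \<in> B \<Longrightarrow> 0 \<le> \<beta> j"
  shows "0 \<le> (\<Sum>j\<in>A. x j * \<alpha> j) * (\<Sum>j\<in>B. y j * \<beta> j) - (\<Sum>j\<in>B. x j * \<beta> j) * (\<Sum>j\<in>A. y j * \<alpha> j)"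
proof -
  let ?x = "\<Sum>j\<in>B. x j * \<beta> j" and ?y = "\<Sum>j\<in>B. y j * \<beta> j"
  \<comment> \<open>The column over \<open>B\<close> is summed first. The zero term fills the third
    row expected by \<open>nonneg_combination\<close>.\<close>
  have "0 \<le> ?y * x j + (- ?x) * y j + 0 * 0" if "j \<in> A" for j
    using nonneg_combination[of B "- y j" x "x j" y 0 "\<lambda>_. 0" \<beta>] assms that
    by (auto simp: algebra_simps)
  from nonneg_combination[of A ?y x "- ?x" y 0 "\<lambda>_. 0" \<alpha>, OF _ assms(2)] this show ?thesis
    by (simp add: mult.commute)
qed

text \<open>The columns are summed one at a time, over \<open>C\<close>, then \<open>B\<close>, then
  \<open>A\<close>, each time after expanding the determinant along the column to be summed.\<close>

lemma aggregated_minor_3: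
  fixes x y z :: "'a \<Rightarrow> real"
  defines "X A \<alpha> \<equiv> \<Sum>j\<in>A. x j * \<alpha> j" and "Y A \<alpha> \<equiv> \<Sum>j\<in>A. y j * \<alpha> j"
    and "Z A \<alpha> \<equiv> \<Sum>j\<in>A. z j * \<alpha> j"
  assumes pos: "\<And>j k l. j \<in> A \<Longrightarrow> k \<in> B \<Longrightarrow> l \<in> C \<Longrightarrow>
      0 \<le> x j * (y k * z l - y l * z k) - x k * (y j * z l - y l * z j)
        + x l * (y j * z k - y k * z j)"
    and w: "\<And>j. j \<in> A \<Longrightarrow> 0 \<le> \<alpha> j" "\<And>j. j \<in> B \<Longrightarrow> 0 \<le> \<beta> j" "\<And>j. j \<in> C \<Longrightarrow> 0 \<le> \<gamma> j"
  shows "0 \<le> X A \<alpha> * (Y B \<beta> * Z C \<gamma> - Y C \<gamma> * Z B \<beta>) - X B \<beta> * (Y A \<alpha> * Z C \<gamma> - Y C \<gamma> * Z A \<alpha>)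
    + X C \<gamma> * (Y A \<alpha> * Z B \<beta> - Y B \<beta> * Z A \<alpha>)"
proof -
  have 1: "0 \<le> x j * (y k * Z C \<gamma> - Y C \<gamma> * z k) - x k * (y j * Z C \<gamma> - Y C \<gamma> * z j)
        + X C \<gamma> * (y j * z k - y k * z j)" if "j \<in> A" "k \<in> B" for j k
  proof -
    have "0 \<le> (y j * z k - y k * z j) * x l + (x k * z j - x j * z k) * y l
        + (x j * y k - x k * y j) * z l" if "l \<in> C" for l
      using pos[OF \<open>j \<in> A\<close> \<open>k \<in> B\<close> that] by (simp add: algebra_simps)
    from nonneg_combination[of C _ x _ y _ z \<gamma>, OF this w(3)] show ?thesis
      by (simp add: algebra_simps X_def Y_def Z_def)
  qed
  have 2: "0 \<le> x j * (Y B \<beta> * Z C \<gamma> - Y C \<gamma> * Z B \<beta>) - X B \<beta> * (y j * Z C \<gamma> - Y C \<gamma> * z j)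
        + X C \<gamma> * (y j * Z B \<beta> - Y B \<beta> * z j)" if "j \<in> A" for j
  proof -
    have "0 \<le> (Y C \<gamma> * z j - y j * Z C \<gamma>) * x k + (x j * Z C \<gamma> - X C \<gamma> * z j) * y k
        + (X C \<gamma> * y j - x j * Y C \<gamma>) * z k" if "k \<in> B" for k
      using 1[OF \<open>j \<in> A\<close> that] by (simp add: algebra_simps)
    from nonneg_combination[of B _ x _ y _ z \<beta>, OF this w(2)] show ?thesis
      by (simp add: algebra_simps X_def[of B] Y_def[of B] Z_def[of B])
  qed
  have "0 \<le> (Y B \<beta> * Z C \<gamma> - Y C \<gamma> * Z B \<beta>) * x j + (X C \<gamma> * Z B \<beta> - X B \<beta> * Z C \<gamma>) * y j
      + (X B \<beta> * Y C \<gamma> - X C \<gamma> * Y B \<beta>) * z j" if "j \<in> A" for j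
    using 2[OF that] by (simp add: algebra_simps)
  from nonneg_combination[of A _ x _ y _ z \<alpha>, OF this w(1)] show ?thesis
    by (simp add: algebra_simps X_def[of A] Y_def[of A] Z_def[of A])
qed

lemma no_plus_minus_plus:
  fixes a1 a2 a3 b1 b2 b3 c1 c2 c3 :: real
  assumes nonneg: "0 \<le> a1" "0 \<le> a2" "0 \<le> b2" "0 \<le> c2" "0 \<le> c3"
    and ac: "0 \<le> a1 * c2 - c1 * a2" "0 \<le> a1 * c3 - c1 * a3" "0 \<le> a2 * c3 - c2 * a3"
    and ab: "0 \<le> a1 * b2 - b1 * a2" and bc: "0 \<le> b2 * c3 - c2 * b3"
    and abc: "0 \<le> a1 * (b2 * c3 - c2 * b3) - b1 * (a2 * c3 - c2 * a3) + c1 * (a2 * b3 - b2 * a3)"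
    and y: "0 < b1 - a1 - c1" "b2 - a2 - c2 < 0" "0 < b3 - a3 - c3"
  shows False
proof -
  define y1 y2 y3 where y_defs: "y1 = b1 - a1 - c1" "y2 = b2 - a2 - c2" "y3 = b3 - a3 - c3"
  \<comment> \<open>Since \<open>y\<close> differs from \<open>b\<close> by a combination of the
    other two columns, the determinant is unchanged. The signs of \<open>y\<close> make all three
    terms of its expansion nonpositive, so each is zero.\<close>
  have "0 \<le> - (y1 * (a2 * c3 - c2 * a3)) + y2 * (a1 * c3 - c1 * a3) - y3 * (a1 * c2 - c1 * a2)"
    using abc by (simp add: y_defs algebra_simps)
  moreover have "0 \<le> y1 * (a2 * c3 - c2 * a3)" "y2 * (a1 * c3 - c1 * a3) \<le> 0"
      "0 \<le> y3 * (a1 * c2 - c1 * a2)"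
    using ac y unfolding y_defs by (auto intro: mult_nonneg_nonneg mult_nonpos_nonneg)
  ultimately have "y1 * (a2 * c3 - c2 * a3) = 0" "y3 * (a1 * c2 - c1 * a2) = 0" by linarith+
  then have z: "a2 * c3 - c2 * a3 = 0" "a1 * c2 - c1 * a2 = 0" using y unfolding y_defs by auto
  \<comment> \<open>Substitute b = y + a + c in \<open>ab\<close>: the part from \<open>a\<close>
    cancels and the part from \<open>c\<close> is a vanishing minor. The argument for
    \<open>c2\<close> is symmetric.\<close>
  have "a2 * y1 \<le> a1 * y2" using ab z(2) by (simp add: y_defs algebra_simps)
  also have "\<dots> \<le> 0" using nonneg y unfolding y_defs by (intro mult_nonneg_nonpos) auto
  finally have "a2 = 0" using nonneg y unfolding y_defs by (auto simp: mult_le_0_iff)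
  have "c2 * y3 \<le> c3 * y2" using bc z(1) by (simp add: y_defs algebra_simps)
  also have "\<dots> \<le> 0" using nonneg y unfolding y_defs by (intro mult_nonneg_nonpos) auto
  finally have "c2 = 0" using nonneg y unfolding y_defs by (auto simp: mult_le_0_iff)
  with \<open>a2 = 0\<close> nonneg y show False by simp
qed

section \<open>Preservation of quasiconcavity by the kernel\<close>

text \<open>Domination by a multiple of the summable row gives absolute convergence, so the infinite
  sum is a true value and not the default 0.\<close>

lemma stochastic_has_sum:
  assumes "stochastic I K" "bounded (u ` {1..})" "n \<in> I"
  shows "((\<lambda>j. K n j * u j) has_sum (\<Sum>\<^sub>\<infinity>j\<in>{1..}. K n j * u j)) {1..}"
proof -
  obtain M where M: "\<And>j. j \<in> {1..} \<Longrightarrow> \<bar>u j\<bar> \<le> M"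
    using assms(2) unfolding bounded_real by auto
  have "(\<lambda>j. K n j * M) summable_on {1..}"
    using assms(1,3) unfolding stochastic_def
    by (intro summable_on_cmult_left) (auto simp: summable_on_def)
  then have "(\<lambda>j. norm (K n j * u j)) summable_on {1..}"
  proof (rule summable_on_comparison_test)
    fix j :: nat assume "j \<in> {1..}"
    with assms(1,3) M[of j] show "norm (K n j * u j) \<le> K n j * M"
      unfolding stochastic_def by (auto simp: abs_mult intro!: mult_left_mono)
  qed simp
  then show ?thesis by (rule has_sum_infsum[OF abs_summable_summable])
qed

lemma quasiconcave_stochastic_TP3:
  assumes K: "stochastic I K" and u: "bounded (u ` {1..})" "quasiconcave_seq {1..} u"
    and v: "\<And>n. n \<in> I \<Longrightarrow> v n = (\<Sum>\<^sub>\<infinity>j\<in>{1..}. K n j * u j)"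
    and TP: "totally_positive 3 I {1..} K"
  shows "quasiconcave_seq I v"
  unfolding quasiconcave_seq_def
proof (intro ballI impI, rule ccontr)
  fix n1 n2 n3 assume I: "n1 \<in> I" "n2 \<in> I" "n3 \<in> I" and ord: "n1 < n2" "n2 < n3"
  assume "\<not> min (v n1) (v n3) \<le> v n2"
  then obtain l where l: "v n2 < l" "l < min (v n1) (v n3)" using dense by (metis not_le)
  define w where "w j = u j - l" for j
  \<comment> \<open>As the row sums to 1, subtracting \<open>l\<close> from \<open>u\<close>
    subtracts \<open>l\<close> from \<open>v n\<close>.\<close>
  have lim: "((\<lambda>F. \<Sum>j\<in>F. K n j * w j) \<longlongrightarrow> v n - l) (finite_subsets_at_top {1..})" if "n \<in> I" for n
  proof -
    have "((\<lambda>j. K n j * u j + K n j * - l) has_sum v n + 1 * - l) {1..}"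
      using stochastic_has_sum[OF K u(1) that] K that v[OF that]
      by (intro has_sum_add has_sum_cmult_left) (auto simp: stochastic_def)
    then show ?thesis by (simp add: has_sum_def w_def algebra_simps)
  qed
  \<comment> \<open>Strict inequalities between limits hold eventually along the finite sets of
    columns, so one set \<open>F\<close> serves all three rows.\<close>
  have "\<forall>\<^sub>F F in finite_subsets_at_top {1..}. 0 < (\<Sum>j\<in>F. K n1 j * w j) \<and>
      (\<Sum>j\<in>F. K n2 j * w j) < 0 \<and> 0 < (\<Sum>j\<in>F. K n3 j * w j) \<and> finite F \<and> F \<subseteq> {1..}"
    using l I by (intro eventually_conj order_tendstoD[OF lim] eventually_finite_subsets_at_top_weakI) auto
  from eventually_happens'[OF finite_subsets_at_top_neq_bot this]
  obtain F where F: "finite F" "F \<subseteq> {1..}" and y: "0 < (\<Sum>j\<in>F. K n1 j * w j)"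
    "(\<Sum>j\<in>F. K n2 j * w j) < 0" "0 < (\<Sum>j\<in>F. K n3 j * w j)"
    by blast
  define B where "B = {j\<in>F. w j > 0}"
  define A where "A = {j\<in>F. \<forall>k\<in>B. j < k}"
  define C where "C = F - A - B"
  have "B \<noteq> {}"
  proof
    assume "B = {}"
    then have "(\<Sum>j\<in>F. K n1 j * w j) \<le> 0"
      using K I F unfolding B_def stochastic_def
      by (intro sum_nonpos mult_nonneg_nonpos) (auto simp: not_less)
    with y show False by simp
  qed
  have AB: "j < k" if "j \<in> A" "k \<in> B" for j k using that by (simp add: A_def)
  \<comment> \<open>An index \<open>k\<close> of \<open>C\<close> lies after some \<open>i\<close>
    in \<open>B\<close>, being outside \<open>A\<close>. If it also preceded \<open>j\<close> in
    \<open>B\<close>, quasiconcavity would put it into \<open>B\<close>.\<close>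
  have BC: "j < k" if "j \<in> B" "k \<in> C" for j k
  proof (rule ccontr)
    assume "\<not> j < k"
    with that have "k < j" by (metis C_def DiffE linorder_neqE_nat)
    have "k \<in> F" "k \<notin> A" using that by (auto simp: C_def)
    then obtain i where i: "i \<in> B" "\<not> k < i" by (auto simp: A_def)
    with that have "i < k" by (metis C_def DiffE linorder_neqE_nat)
    have "min (u i) (u j) \<le> u k"
      using u(2) F that i \<open>i < k\<close> \<open>k < j\<close> unfolding quasiconcave_seq_def B_def C_def by blast
    then have "w k > 0" using i that by (auto simp: B_def w_def)
    with that show False by (auto simp: B_def C_def)
  qed
  \<comment> \<open>Any element of the nonempty set \<open>B\<close> separates the two
    indices.\<close>
  have AC: "j < k" if "j \<in> A" "k \<in> C" for j k
    using AB BC that \<open>B \<noteq> {}\<close> by (meson ex_in_conv less_trans)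
  have sub: "A \<subseteq> {1..}" "B \<subseteq> {1..}" "C \<subseteq> {1..}" using F by (auto simp: A_def B_def C_def)
  have Apos: "0 \<le> - w j" if "j \<in> A" for j using that by (force simp: A_def B_def)
  have Bpos: "0 \<le> w j" if "j \<in> B" for j using that by (simp add: B_def)
  have Cpos: "0 \<le> - w j" if "j \<in> C" for j using that by (force simp: C_def B_def)
  define a where "a n = (\<Sum>j\<in>A. K n j * - w j)" for n
  define b where "b n = (\<Sum>j\<in>B. K n j * w j)" for n
  define c where "c n = (\<Sum>j\<in>C. K n j * - w j)" for n
  have split: "(\<Sum>j\<in>F. K n j * w j) = b n - a n - c n" for n
  proof -
    have fin: "finite A" "finite B" "finite C" using F by (auto simp: A_def B_def C_def)
    have "F = A \<union> (B \<union> C)" by (auto simp: A_def B_def C_def)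
    moreover have "A \<inter> (B \<union> C) = {}" "B \<inter> C = {}" using AB AC BC by fastforce+
    ultimately show ?thesis
      using fin by (simp add: sum.union_disjoint a_def b_def c_def sum_negf)
  qed
  have nonneg: "0 \<le> a n" "0 \<le> b n" "0 \<le> c n" if "n \<in> I" for n
  proof -
    have "0 \<le> K n j" if "j \<in> {1..}" for j
      using K \<open>n \<in> I\<close> that unfolding stochastic_def by blast
    then show "0 \<le> a n" "0 \<le> b n" "0 \<le> c n" using sub Apos Bpos Cpos
      unfolding a_def b_def c_def by (auto intro!: sum_nonneg mult_nonneg_nonneg simp del: mult_minus_right)
  qed
  have K2: "0 \<le> K n j * K m k - K n k * K m j"
    if "n \<in> I" "m \<in> I" "n < m" "j \<in> {1..}" "k \<in> {1..}" "j < k" for n m j k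
    using totally_positive_minor_2[OF TP] that by simp
  have ab: "0 \<le> a n * b m - b n * a m" and bc: "0 \<le> b n * c m - c n * b m"
    and ac: "0 \<le> a n * c m - c n * a m" if "n \<in> I" "m \<in> I" "n < m" for n m
  proof -
    have K2': "0 \<le> K n j * K m k - K n k * K m j"
      if "j \<in> {1..}" "k \<in> {1..}" "j < k" for j k
      using K2 \<open>n \<in> I\<close> \<open>m \<in> I\<close> \<open>n < m\<close> that by blast
    show "0 \<le> a n * b m - b n * a m" unfolding a_def b_def
      by (rule aggregated_minor_2[OF K2' Apos Bpos]) (use sub AB in auto)
    show "0 \<le> b n * c m - c n * b m" unfolding b_def c_def
      by (rule aggregated_minor_2[OF K2' Bpos Cpos]) (use sub BC in auto)
    show "0 \<le> a n * c m - c n * a m" unfolding a_def c_def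
      by (rule aggregated_minor_2[OF K2' Apos Cpos]) (use sub AC in auto)
  qed
  have abc: "0 \<le> a n1 * (b n2 * c n3 - c n2 * b n3) - b n1 * (a n2 * c n3 - c n2 * a n3)
      + c n1 * (a n2 * b n3 - b n2 * a n3)"
    unfolding a_def b_def c_def
  proof (rule aggregated_minor_3[OF _ Apos Bpos Cpos])
    fix j k l assume "j \<in> A" "k \<in> B" "l \<in> C"
    then have "{j, k, l} \<subseteq> {1..}" "j < k" "k < l" using sub AB BC by blast+
    with totally_positive_minor_3[OF TP _ _ ord] I
    show "0 \<le> K n1 j * (K n2 k * K n3 l - K n2 l * K n3 k)
        - K n1 k * (K n2 j * K n3 l - K n2 l * K n3 j)
        + K n1 l * (K n2 j * K n3 k - K n2 k * K n3 j)" by simp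
  qed
  show False
    using no_plus_minus_plus[OF nonneg(1)[OF I(1)] nonneg[OF I(2)] nonneg(3)[OF I(3)]
        ac[OF I(1,2) ord(1)] ac[OF I(1,3) less_trans[OF ord]] ac[OF I(2,3) ord(2)]
        ab[OF I(1,2) ord(1)] bc[OF I(2,3) ord(2)] abc] y
    unfolding split by simp
qed

theorem theorem2:
  fixes I :: "nat set" and K :: "nat \<Rightarrow> nat \<Rightarrow> real" and u v :: "nat \<Rightarrow> real"
  assumes "I = {1..} \<or> (\<exists>N\<ge>1. I = {1..N})"
    and "stochastic I K"
    and "bounded (u ` {1..})"
    and "quasi_unimodal {1..} u"
    and "\<And>n. n \<in> I \<Longrightarrow> v n = (\<Sum>\<^sub>\<infinity>j\<in>{1..}. K n j * u j)"
    and "totally_positive 3 I {1..} K"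
  shows "quasi_unimodal I v
    \<and> ((SUP n\<in>I. v n) \<in> v ` I \<longrightarrow> unimodal I v)
    \<and> (finite I \<longrightarrow> unimodal I v)"
proof (intro conjI impI)
  have v: "quasiconcave_seq I v"
    by (rule quasiconcave_stochastic_TP3[OF assms(2,3) quasi_unimodal_imp_quasiconcave[OF assms(4)]
          assms(5,6)])
  then show "quasi_unimodal I v" by (rule quasiconcave_imp_quasi_unimodal)
  show "unimodal I v" if "finite I"
  proof -
    have "I \<noteq> {}" using assms(1) by auto
    with that have "Max (v ` I) \<in> v ` I" by (intro Max_in) auto
    then obtain p where "p \<in> I" "v p = Max (v ` I)" by force
    with that show ?thesis by (intro quasiconcave_imp_unimodal[OF v, of p]) auto
  qed
  show "unimodal I v" if SUP: "(SUP n\<in>I. v n) \<in> v ` I"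
  proof -
    \<comment> \<open>The real \<open>SUP\<close> is known to be an upper bound only for a set
      bounded above. An upper bound of \<open>u\<close> carries over to \<open>v\<close>, because
      the rows are nonnegative with sum 1.\<close>
    obtain M where M: "\<And>j. j \<in> {1..} \<Longrightarrow> u j \<le> M"
      using assms(3) unfolding bounded_real by (auto dest: abs_le_D1)
    have "v n \<le> M" if "n \<in> I" for n
    proof -
      have "((\<lambda>j. K n j * M) has_sum 1 * M) {1..}"
        using assms(2) that by (intro has_sum_cmult_left) (auto simp: stochastic_def)
      moreover have "((\<lambda>j. K n j * u j) has_sum v n) {1..}"
        using stochastic_has_sum[OF assms(2,3) that] assms(5)[OF that] by simp
      ultimately have "v n \<le> 1 * M"
        using assms(2) that M unfolding stochastic_def
        by (elim has_sum_mono[rotated]) (auto intro!: mult_left_mono)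
      then show ?thesis by simp
    qed
    then have "bdd_above (v ` I)" by (rule bdd_aboveI2)
    moreover obtain p where "p \<in> I" "v p = (SUP n\<in>I. v n)" using SUP by force
    ultimately show ?thesis
      by (intro quasiconcave_imp_unimodal[OF v, of p]) (auto intro: cSUP_upper)
  qed
qed

end
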